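(* Suppose there exist constants $\underline{w}>0$ and $\bar{w}>0$ such that $\underline{w}\le \hat{w}(c,z)\le \bar{w}$ for all $(c,z)$, and suppose the density ratio estimate is perfect, i.e. $\hat{w}(c,z)=w(c,z)=q(c,z)/p(c,z)$ for all $(c,z)$. Then the uncertainty set $\mathcal{U}_\alpha(z)=[\hat f(z)-\eta\hat h(z),\ \hat f(z)+\eta\hat h(z)]$ generated by Algorithm OOD-RO (described in the context) satisfies $$\Big|\mathbb{P}\big(c_{\mathrm{new}}\in\mathcal{U}_\alpha(z_{\mathrm{new}})\big)-\alpha\Big|\le \frac{1}{|\mathcal{D}_2|+1}\cdot\frac{\bar{w}}{\underline{w}},$$ where the probability is with respect to $(c_{\mathrm{new}},z_{\mathrm{new}})\sim\mathcal{Q}$ and $\mathcal{D}_2\sim\mathcal{P}$ (the points of $\mathcal{D}_2$ are i.i.d. from $\mathcal{P}$ and independent of $(c_{\mathrm{new}},z_{\mathrm{new}})$).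
   Context: Setting. $\mathcal{P}$ (training distribution) and $\mathcal{Q}$ (test distribution) are probability distributions of pairs $(c,z)\in\mathbb{R}^n\times\mathbb{R}^d$, where $c$ is an objective vector and $z$ a covariate vector. All distributions (joint, marginal, conditional) are assumed to have density functions with respect to Lebesgue measure; $p(c,z)$ and $q(c,z)$ denote the joint densities of $\mathcal{P}$ and $\mathcal{Q}$. The density ratio is $w(c,z)=q(c,z)/p(c,z)$ and is assumed well-defined everywhere. The target level is $\alpha\in(0,1)$. Algorithm OOD-RO (box uncertainty set). Inputs: training data $\mathcal{D}_{\mathrm{Tr}}$ consisting of i.i.d. samples $(c_i,z_i)$ from $\mathcal{P}$; a prediction model $\hat f:\mathbb{R}^d\to\mathbb{R}^n$ (for $\mathbb{E}[c|z]$); a density ratio estimate $\hat w(c,z)$; the level $\alpha$. 1. Randomly split $\mathcal{D}_{\mathrm{Tr}}=\mathcal{D}_1\cup\mathcal{D}_2$ with $\mathcal{D}_1\cap\mathcal{D}_2=\emptyset$. 2. For $(c_i,z_i)\in\mathcal{D}_1$ let $r_i=c_i-\hat f(z_i)=(r_{i,1},\dots,r_{i,n})^\top$. Learn a quantile regression model $\hat h:\mathbb{R}^d\to\mathbb{R}^n$ (from any chosen model class) by minimizing $\sum_{(c_i,z_i)\in\mathcal{D}_1}\sum_{k=1}^n\rho_\alpha\big(\hat h(z_i)_k-|r_{i,k}|\big)$, where $\rho_\alpha(u)=\alpha\,u^+ +(1-\alpha)\,u^-$, $u^+=\max(u,0)$, $u^-=\max(-u,0)$. No accuracy or structural assumption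 is made on $\hat f$ or $\hat h$. 3. For $(c_i,z_i)\in\mathcal{D}_2$ let $\bar c_i(\eta)=\hat f(z_i)+\eta\hat h(z_i)$ and $\underline{c}_i(\eta)=\hat f(z_i)-\eta\hat h(z_i)$. Choose the minimal $\eta>0$ such that $$\sum_{(c_i,z_i)\in\mathcal{D}_2}\frac{\hat w(c_i,z_i)\,\mathbf{1}\{\underline{c}_i(\eta)\le c_i\le\bar c_i(\eta)\}}{\sum_{(c_j,z_j)\in\mathcal{D}_2}\hat w(c_j,z_j)}\ \ge\ \alpha,$$ where inequalities between vectors are component-wise. The algorithm presupposes that such a minimal $\eta$ exists (almost surely over $\mathcal{D}_2$). 4. Output $\hat h$ and $\eta$, and for every $z$ the box $\mathcal{U}_\alpha(z)=[\hat f(z)-\eta\hat h(z),\hat f(z)+\eta\hat h(z)]$, i.e. the set of $c\in\mathbb{R}^n$ with $\hat f(z)-\eta\hat h(z)\le c\le\hat f(z)+\eta\hat h(z)$ component-wise. Convention: since the probability is taken only over $\mathcal{D}_2$ and $(c_{\mathrm{new}},z_{\mathrm{new}})$, the functions $\hat f,\hat h,\hat w$ are fixed measurable functions not depending on $\mathcal{D}_2$ or $(c_{\mathrm{new}},z_{\mathrm{new}})$, while $\eta$ is a function of $\mathcal{D}_2$. *)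

theory Defs
  imports "HOL-Probability.Probability"
begin

text \<open>
  A data point is a pair \<open>(c, z)\<close> of an objective vector and a covariate vector; a sample is a
  family of data points, evaluated on a finite index set. The order on \<^typ>\<open>real ^ 'n\<close> is
  component-wise, so \<open>{a..b}\<close> is a box.
\<close>

type_synonym ('n, 'd) point = "(real ^ 'n) \<times> (real ^ 'd)"

text \<open>The argument is prediction minus target, so over-prediction carries the weight \<open>\<alpha>\<close>.\<close>

definition pinball_loss :: "real \<Rightarrow> real \<Rightarrow> real" where
  "pinball_loss \<alpha> u = \<alpha> * max u 0 + (1 - \<alpha>) * max (- u) 0"

definition regression_loss ::
  "real \<Rightarrow> (real ^ 'd \<Rightarrow> real ^ 'n) \<Rightarrow> 'i set \<Rightarrow> ('i \<Rightarrow> ('n, 'd) point) \<Rightarrow>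
     (real ^ 'd \<Rightarrow> real ^ 'n) \<Rightarrow> real" where
  "regression_loss \<alpha> f I D h =
     (\<Sum>i\<in>I. case D i of (c, z) \<Rightarrow>
        \<Sum>k\<in>UNIV. pinball_loss \<alpha> (h z $ k - \<bar>(c - f z) $ k\<bar>))"

definition quantile_regression_fit ::
  "real \<Rightarrow> (real ^ 'd \<Rightarrow> real ^ 'n) \<Rightarrow> 'i set \<Rightarrow> ('i \<Rightarrow> ('n, 'd) point) \<Rightarrow>
     (real ^ 'd \<Rightarrow> real ^ 'n) set \<Rightarrow> (real ^ 'd \<Rightarrow> real ^ 'n) \<Rightarrow> bool" where
  "quantile_regression_fit \<alpha> f I D H h \<longleftrightarrow>
     is_arg_min (regression_loss \<alpha> f I D) (\<lambda>g. g \<in> H) h"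

definition pred_box ::
  "(real ^ 'd \<Rightarrow> real ^ 'n) \<Rightarrow> (real ^ 'd \<Rightarrow> real ^ 'n) \<Rightarrow> real \<Rightarrow> real ^ 'd \<Rightarrow> (real ^ 'n) set" where
  "pred_box f h \<eta> z = {f z - \<eta> *\<^sub>R h z .. f z + \<eta> *\<^sub>R h z}"

definition weighted_coverage ::
  "(real ^ 'd \<Rightarrow> real ^ 'n) \<Rightarrow> (real ^ 'd \<Rightarrow> real ^ 'n) \<Rightarrow> (('n, 'd) point \<Rightarrow> real) \<Rightarrow>
     'i set \<Rightarrow> ('i \<Rightarrow> ('n, 'd) point) \<Rightarrow> real \<Rightarrow> real" where
  "weighted_coverage f h w I D \<eta> =
     (\<Sum>i\<in>I. w (D i) * of_bool (fst (D i) \<in> pred_box f h \<eta> (snd (D i))) / (\<Sum>j\<in>I. w (D j)))"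

definition feasible_scale ::
  "(real ^ 'd \<Rightarrow> real ^ 'n) \<Rightarrow> (real ^ 'd \<Rightarrow> real ^ 'n) \<Rightarrow> (('n, 'd) point \<Rightarrow> real) \<Rightarrow> real \<Rightarrow>
     'i set \<Rightarrow> ('i \<Rightarrow> ('n, 'd) point) \<Rightarrow> real \<Rightarrow> bool" where
  "feasible_scale f h w \<alpha> I D \<eta> \<longleftrightarrow> \<eta> > 0 \<and> weighted_coverage f h w I D \<eta> \<ge> \<alpha>"

definition minimal_scale_exists ::
  "(real ^ 'd \<Rightarrow> real ^ 'n) \<Rightarrow> (real ^ 'd \<Rightarrow> real ^ 'n) \<Rightarrow> (('n, 'd) point \<Rightarrow> real) \<Rightarrow> real \<Rightarrow>
     'i set \<Rightarrow> ('i \<Rightarrow> ('n, 'd) point) \<Rightarrow> bool" where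
  "minimal_scale_exists f h w \<alpha> I D \<longleftrightarrow>
     (\<exists>\<eta>. feasible_scale f h w \<alpha> I D \<eta> \<and> (\<forall>\<eta>'. feasible_scale f h w \<alpha> I D \<eta>' \<longrightarrow> \<eta> \<le> \<eta>'))"

text \<open>
  \<^const>\<open>Least\<close> over the reals denotes the minimum exactly when \<^const>\<open>minimal_scale_exists\<close>
  holds; otherwise it is a fixed unspecified real.
\<close>

definition ood_ro_scale ::
  "(real ^ 'd \<Rightarrow> real ^ 'n) \<Rightarrow> (real ^ 'd \<Rightarrow> real ^ 'n) \<Rightarrow> (('n, 'd) point \<Rightarrow> real) \<Rightarrow> real \<Rightarrow>
     'i set \<Rightarrow> ('i \<Rightarrow> ('n, 'd) point) \<Rightarrow> real" where
  "ood_ro_scale f h w \<alpha> I D = (LEAST \<eta>. feasible_scale f h w \<alpha> I D \<eta>)"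

definition ood_ro_set ::
  "(real ^ 'd \<Rightarrow> real ^ 'n) \<Rightarrow> (real ^ 'd \<Rightarrow> real ^ 'n) \<Rightarrow> (('n, 'd) point \<Rightarrow> real) \<Rightarrow> real \<Rightarrow>
     'i set \<Rightarrow> ('i \<Rightarrow> ('n, 'd) point) \<Rightarrow> real ^ 'd \<Rightarrow> (real ^ 'n) set" where
  "ood_ro_set f h w \<alpha> I D = pred_box f h (ood_ro_scale f h w \<alpha> I D)"

end

theory Submission
  imports Defs "HOL-Combinatorics.Transposition"
begin

text \<open>
  The proof turns the algorithm into weighted split conformal prediction and then computes the
  coverage exactly enough by a change of measure.

  Give every data point a score in \<open>[0, \<infinity>]\<close>, the infimum of the positive scales at which the
  box around the prediction contains the point. The chosen scale \<open>\<eta>\<close> is then the least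
  number for which the sample points with score at most \<open>\<eta>\<close> carry a fraction \<open>\<alpha>\<close> of the
  weight, and the test point is covered exactly when the sample points with strictly smaller score
  carry less than this fraction (\<open>mem_ood_ro_set_iff\<close>). The second form no longer mentions
  \<open>\<eta>\<close>, and it makes sense for each of the \<open>m + 1\<close> points in the role of the test point, where
  \<open>m\<close> is the sample size; this is \<open>below_quantile\<close>.

  Two facts about this event give the bound. First, for fixed points \<open>x\<^sub>j\<close> with distinct scores
  and total weight \<open>W\<close>, the points that are covered by the remaining ones carry weight
  \<open>\<alpha> W\<close>, up to the weight of one point (\<open>below_quantile_total_weight\<close>). Second, since
  \<open>w\<close> is the density ratio, the joint law of sample and test point is that of \<open>m + 1\<close>
  independent points from the training law, reweighted by \<open>w\<close> at the test point
  (\<open>emeasure_PiM_change_one\<close>). The training law of the \<open>m + 1\<close> points is invariant under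
  permutations, so the coverage probability equals the expectation of
  \<open>w(x\<^sub>j) 1{x\<^sub>j is covered by the others}\<close> for every \<open>j\<close>. Summing over \<open>j\<close>, and
  using that \<open>w\<close> has mean 1, \<open>m + 1\<close> times the coverage differs from \<open>(m + 1) \<alpha>\<close> by
  at most the upper bound of \<open>w\<close> (\<open>weighted_conformal_coverage\<close>). The lower bound of
  \<open>w\<close> is at most its mean 1, so dividing by it only enlarges the bound.

  Scores are almost surely distinct. A given finite score confines the objective to finitely many
  hyperplanes once the covariate is fixed, which is a Lebesgue null set
  (\<open>AE_lborel_score_neq\<close>). An infinite score is ruled out by the existence of a minimal scale:
  if it had positive probability, then with positive probability all sample points would have one,
  and no scale would be feasible (\<open>null_sets_if_AE_not_all_in\<close>).
\<close>


section \<open>Distinct scores: the coverage averaged over which point plays the test point\<close>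

text \<open>
  The threshold is a fraction of the weight of the other points, since the algorithm normalises by
  the weight of the sample without the test point. The sum on the left may range over all of \<open>J\<close>,
  because the strict inequality excludes \<open>j\<close>.
\<close>

definition below_quantile :: "real \<Rightarrow> ('k \<Rightarrow> real) \<Rightarrow> ('k \<Rightarrow> 'b::linorder) \<Rightarrow> 'k set \<Rightarrow> 'k \<Rightarrow> bool" where
  "below_quantile \<alpha> w s J j \<longleftrightarrow> (\<Sum>l\<in>J. w l * of_bool (s l < s j)) < \<alpha> * (\<Sum>l\<in>J - {j}. w l)"

text \<open>
  Call the indices below the quantile selected, and write \<open>K\<close> for their set, \<open>L j\<close> for the
  indices with score below that of \<open>j\<close> and \<open>W\<close> for the total weight. Selection of \<open>j\<close> means that \<open>L j\<close> weighs less than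
  \<open>\<alpha> (W - w j)\<close>. The selected index with the largest score bounds the weight of \<open>K\<close> from above,
  as \<open>K\<close> has no index beyond \<open>L j\<close> and \<open>j\<close> itself; here distinctness of the scores enters.
  The unselected index with the smallest score bounds it from below, as \<open>K\<close> contains \<open>L j\<close>.
  The errors are \<open>(1 - \<alpha>) w j\<close> and \<open>\<alpha> w j\<close>.
\<close>

lemma below_quantile_total_weight:
  fixes w :: "'k \<Rightarrow> real" and s :: "'k \<Rightarrow> 'b::linorder"
  assumes fin: "finite J" and w: "\<And>j. j \<in> J \<Longrightarrow> 0 \<le> w j \<and> w j \<le> b" and "0 \<le> b"
    and inj: "inj_on s J" and \<alpha>: "0 \<le> \<alpha>" "\<alpha> \<le> 1"
  shows "\<bar>(\<Sum>j\<in>J. w j * of_bool (below_quantile \<alpha> w s J j)) - \<alpha> * (\<Sum>j\<in>J. w j)\<bar> \<le> b"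
proof -
  define K where "K = {j\<in>J. below_quantile \<alpha> w s J j}"
  define W where "W = (\<Sum>j\<in>J. w j)"
  define L where "L j = {l\<in>J. s l < s j}" for j
  have finK: "finite K" "K \<subseteq> J" and finL: "finite (L j)" "L j \<subseteq> J" for j
    using fin by (auto simp: K_def L_def)
  have sumK: "(\<Sum>j\<in>J. w j * of_bool (below_quantile \<alpha> w s J j)) = sum w K"
    using fin unfolding K_def sum.inter_filter[OF fin] by (intro sum.cong) auto
  have sumL: "(\<Sum>l\<in>J. w l * of_bool (s l < s j)) = sum w (L j)" for j
    using fin unfolding L_def sum.inter_filter[OF fin] by (intro sum.cong) auto
  have below: "below_quantile \<alpha> w s J j \<longleftrightarrow> sum w (L j) < \<alpha> * (W - w j)" if "j \<in> J" for j
    using that fin by (simp add: below_quantile_def sumL W_def sum_diff1)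
  have mono: "sum w A \<le> sum w B" if "A \<subseteq> B" "B \<subseteq> J" for A B
    using that w fin by (intro sum_mono2) (auto intro: finite_subset)
  have W0: "0 \<le> W" using w by (auto simp: W_def intro: sum_nonneg)
  have scale: "\<alpha> * w j \<le> b" "(1 - \<alpha>) * w j \<le> b" if "j \<in> J" for j
  proof -
    show "\<alpha> * w j \<le> b"
      using mult_right_mono[of \<alpha> 1 "w j"] \<alpha> w[OF that] by simp
    show "(1 - \<alpha>) * w j \<le> b"
      using mult_right_mono[of "1 - \<alpha>" 1 "w j"] \<alpha> w[OF that] by simp
  qed
  have upper: "sum w K - \<alpha> * W \<le> b"
  proof (cases "K = {}")
    case True
    then show ?thesis using mult_nonneg_nonneg[OF \<alpha>(1) W0] \<open>0 \<le> b\<close> by simp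
  next
    case False
    then obtain j where j: "j \<in> K" "\<And>l. l \<in> K \<Longrightarrow> s l \<le> s j"
      using finK(1) obtains_MAX[of K s] by (metis Max_ge finite_imageI imageI)
    have "j \<in> J" using j finK by auto
    have "K \<subseteq> insert j (L j)"
    proof
      fix l assume l: "l \<in> K"
      then have "l \<in> J" using finK(2) by auto
      then show "l \<in> insert j (L j)"
        using j(2)[OF l] inj_onD[OF inj, of l j] \<open>j \<in> J\<close> by (cases "s l = s j") (auto simp: L_def)
    qed
    then have "sum w K \<le> sum w (insert j (L j))"
      using \<open>j \<in> J\<close> finL by (intro mono) auto
    also have "\<dots> = w j + sum w (L j)"
      using finL by (subst sum.insert) (auto simp: L_def)
    also have "sum w (L j) < \<alpha> * (W - w j)"
      using j(1) below[OF \<open>j \<in> J\<close>] by (simp add: K_def)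
    finally show ?thesis
      using scale(2)[OF \<open>j \<in> J\<close>] by (simp add: algebra_simps)
  qed
  have lower: "\<alpha> * W - sum w K \<le> b"
  proof (cases "K = J")
    case True
    have "\<alpha> * W \<le> 1 * W" using W0 \<alpha> by (intro mult_right_mono) auto
    then show ?thesis using True \<open>0 \<le> b\<close> by (simp add: W_def)
  next
    case False
    then obtain j where j: "j \<in> J - K" "\<And>l. l \<in> J - K \<Longrightarrow> s j \<le> s l"
      using finK fin obtains_MIN[of "J - K" s]
      by (metis Diff_eq_empty_iff Min_le finite_Diff finite_imageI imageI subset_antisym)
    have "L j \<subseteq> K" using j(2) by (force simp: L_def)
    then have "sum w (L j) \<le> sum w K" using finK by (intro mono)
    moreover have "\<alpha> * (W - w j) \<le> sum w (L j)"
      using j(1) below[of j] by (auto simp: K_def)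
    ultimately show ?thesis
      using scale(1)[of j] j(1) by (simp add: algebra_simps)
  qed
  show ?thesis
    using upper lower by (simp add: sumK W_def abs_le_iff)
qed

section \<open>Independent points\<close>

text \<open>
  Conditionally on all other points, a tie of point \<open>i\<close> with point \<open>j\<close> asks the score of point
  \<open>i\<close> to take one prescribed value.
\<close>

lemma AE_PiM_inj_on:
  fixes S :: "'b \<Rightarrow> ereal"
  assumes "prob_space N" and fin: "finite J" and S[measurable]: "S \<in> borel_measurable N"
    and atomless: "\<And>t. AE x in N. S x \<noteq> t"
  shows "AE x in Pi\<^sub>M J (\<lambda>_. N). inj_on (\<lambda>j. S (x j)) J"
proof -
  interpret N: prob_space N by fact
  interpret product_sigma_finite "\<lambda>_. N" by unfold_locales
  have "AE x in Pi\<^sub>M J (\<lambda>_. N). S (x i) \<noteq> S (x j)" if ij: "i \<in> J" "j \<in> J" "i \<noteq> j" for i j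
  proof -
    define J' where "J' = J - {i}"
    have J: "J = insert i J'" "finite J'" "i \<notin> J'" "j \<in> J'" using ij fin by (auto simp: J'_def)
    have comp: "(\<lambda>x. S (x l)) \<in> borel_measurable (Pi\<^sub>M J (\<lambda>_. N))" if "l \<in> J" for l
      using measurable_compose[OF measurable_component_singleton[OF that] S] .
    let ?f = "\<lambda>x. of_bool (S (x i) = S (x j)) :: ennreal"
    have [measurable]: "Measurable.pred (Pi\<^sub>M J (\<lambda>_. N)) (\<lambda>x. S (x i) = S (x j))"
      unfolding Measurable.pred_def using comp[OF ij(1)] comp[OF ij(2)] by (rule borel_measurable_eq)
    have f: "?f \<in> borel_measurable (Pi\<^sub>M J (\<lambda>_. N))" by measurable
    have "(\<integral>\<^sup>+ a. ?f (y(i := a)) \<partial>N) = 0" for y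
    proof -
      have "(\<integral>\<^sup>+ a. ?f (y(i := a)) \<partial>N) = (\<integral>\<^sup>+ a. 0 \<partial>N)"
        using atomless[of "S (y j)"] ij by (intro nn_integral_cong_AE) auto
      then show ?thesis by simp
    qed
    then have "(\<integral>\<^sup>+ x. ?f x \<partial>Pi\<^sub>M J (\<lambda>_. N)) = 0"
      using f J(2,3) unfolding J(1) by (subst product_nn_integral_insert) auto
    then have "AE x in Pi\<^sub>M J (\<lambda>_. N). ?f x = 0"
      using f by (subst (asm) nn_integral_0_iff_AE) auto
    then show ?thesis by simp
  qed
  then have "AE x in Pi\<^sub>M J (\<lambda>_. N). \<forall>i\<in>J. \<forall>j\<in>J. i \<noteq> j \<longrightarrow> S (x i) \<noteq> S (x j)"
    using fin by (intro AE_finite_allI) (auto intro!: AE_impI)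
  then show ?thesis by eventually_elim (auto simp: inj_on_def)
qed

text \<open>
  The density of one factor becomes a density of the whole product, by integrating over
  that coordinate first.
\<close>

lemma emeasure_PiM_change_one:
  fixes w :: "'b \<Rightarrow> real"
  assumes "prob_space N" and w[measurable]: "w \<in> borel_measurable N"
    and Q: "prob_space (density N (\<lambda>x. ennreal (w x)))"
    and fin: "finite J" and i: "i \<in> J" and E: "E \<in> sets (Pi\<^sub>M J (\<lambda>_. N))"
  shows "emeasure (Pi\<^sub>M J (\<lambda>j. if j = i then density N (\<lambda>x. ennreal (w x)) else N)) E
    = (\<integral>\<^sup>+ x. ennreal (w (x i)) * indicator E x \<partial>Pi\<^sub>M J (\<lambda>_. N))"
proof -
  interpret N: prob_space N by fact
  let ?Q = "density N (\<lambda>x. ennreal (w x))"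
  let ?M = "\<lambda>j. if j = i then ?Q else N"
  have pM: "prob_space (?M j)" for j using Q N.prob_space_axioms by simp
  interpret P: product_sigma_finite "\<lambda>_. N" by unfold_locales
  interpret R: product_sigma_finite ?M
    by (intro product_sigma_finite.intro prob_space_imp_sigma_finite pM)
  define J' where "J' = J - {i}"
  have J: "J = insert i J'" "finite J'" "i \<notin> J'" using i fin by (auto simp: J'_def)
  have sets: "sets (Pi\<^sub>M J ?M) = sets (Pi\<^sub>M J (\<lambda>_. N))"
    by (rule sets_PiM_cong) auto
  have rest: "Pi\<^sub>M J' ?M = Pi\<^sub>M J' (\<lambda>_. N)"
    using J(3) by (intro PiM_cong) auto
  have E': "E \<in> sets (Pi\<^sub>M (insert i J') ?M)" and [measurable]: "E \<in> sets (Pi\<^sub>M (insert i J') (\<lambda>_. N))"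
    using E sets J(1) by simp_all
  have upd: "(\<lambda>a. y(i := a)) \<in> measurable N (Pi\<^sub>M (insert i J') (\<lambda>_. N))"
    if "y \<in> space (Pi\<^sub>M J' (\<lambda>_. N))" for y
    using that by measurable
  have [measurable]: "(\<lambda>x. x i) \<in> measurable (Pi\<^sub>M (insert i J') (\<lambda>_. N)) N"
    by (rule measurable_component_singleton) simp
  have "emeasure (Pi\<^sub>M J ?M) E = (\<integral>\<^sup>+ x. indicator E x \<partial>Pi\<^sub>M (insert i J') ?M)"
    using E' J(1) by simp
  also have "\<dots> = (\<integral>\<^sup>+ y. (\<integral>\<^sup>+ a. indicator E (y(i := a)) \<partial>?Q) \<partial>Pi\<^sub>M J' (\<lambda>_. N))"
    using J(2,3) E' by (subst R.product_nn_integral_insert) (auto simp: rest)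
  also have "\<dots> = (\<integral>\<^sup>+ y. (\<integral>\<^sup>+ a. ennreal (w a) * indicator E (y(i := a)) \<partial>N) \<partial>Pi\<^sub>M J' (\<lambda>_. N))"
  proof (rule nn_integral_cong)
    fix y assume y: "y \<in> space (Pi\<^sub>M J' (\<lambda>_. N))"
    have [measurable]: "(\<lambda>a. indicator E (y(i := a)) :: ennreal) \<in> borel_measurable N"
      using measurable_compose[OF upd[OF y], of "indicator E :: _ \<Rightarrow> ennreal"] by simp
    show "(\<integral>\<^sup>+ a. indicator E (y(i := a)) \<partial>?Q) = (\<integral>\<^sup>+ a. ennreal (w a) * indicator E (y(i := a)) \<partial>N)"
      by (rule nn_integral_density) measurable
  qed
  also have "\<dots> = (\<integral>\<^sup>+ x. ennreal (w (x i)) * indicator E x \<partial>Pi\<^sub>M J (\<lambda>_. N))"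
    using J(2,3) unfolding J(1) by (subst P.product_nn_integral_insert) auto
  finally show ?thesis .
qed

text \<open>
  This exchangeability of i.i.d. points is what lets every point of the sample act as the
  test point.
\<close>

lemma integral_PiM_transpose:
  fixes f :: "('k \<Rightarrow> 'b) \<Rightarrow> real"
  assumes "prob_space N" and ij: "i \<in> J" "j \<in> J"
    and f: "f \<in> borel_measurable (Pi\<^sub>M J (\<lambda>_. N))"
  shows "(\<integral>x. f (\<lambda>l\<in>J. x (Transposition.transpose i j l)) \<partial>Pi\<^sub>M J (\<lambda>_. N)) = (\<integral>x. f x \<partial>Pi\<^sub>M J (\<lambda>_. N))"
proof -
  let ?t = "\<lambda>x. \<lambda>l\<in>J. x (Transposition.transpose i j l)"
  have inJ: "Transposition.transpose i j l \<in> J" if "l \<in> J" for l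
    using that ij by (auto simp: Transposition.transpose_def)
  have "distr (Pi\<^sub>M J (\<lambda>_. N)) (Pi\<^sub>M J (\<lambda>_. N)) ?t = Pi\<^sub>M J (\<lambda>_. N)"
    using assms(1) inJ by (intro distr_PiM_reindex[where M = "\<lambda>_. N"]) auto
  moreover have "?t \<in> measurable (Pi\<^sub>M J (\<lambda>_. N)) (Pi\<^sub>M J (\<lambda>_. N))"
    using inJ by (intro measurable_restrict measurable_component_singleton)
  ultimately show ?thesis
    using f integral_distr[of ?t "Pi\<^sub>M J (\<lambda>_. N)" "Pi\<^sub>M J (\<lambda>_. N)" f] by simp
qed

text \<open>
  The probability that all variables fall into \<open>A\<close> is a product of copies of the mass of \<open>A\<close>.
\<close>

lemma (in prob_space) null_sets_if_AE_not_all_in: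
  assumes indep: "indep_vars (\<lambda>_. L) X I" and I: "finite I" "I \<noteq> {}"
    and law: "\<And>i. i \<in> I \<Longrightarrow> distr M L (X i) = N" and A: "A \<in> sets L"
    and not_all: "AE \<omega> in M. \<not> (\<forall>i\<in>I. X i \<omega> \<in> A)"
  shows "A \<in> null_sets N"
proof -
  have rv: "X i \<in> measurable M L" if "i \<in> I" for i
    using indep that by (simp add: indep_vars_def)
  have "0 = prob {\<omega> \<in> space M. \<forall>i\<in>I. X i \<omega> \<in> A}"
    using not_all by (rule prob_eq_0_AE[symmetric])
  also have "{\<omega> \<in> space M. \<forall>i\<in>I. X i \<omega> \<in> A} = (\<Inter>i\<in>I. X i -` A \<inter> space M)"
    using I by auto
  also have "prob \<dots> = (\<Prod>i\<in>I. prob (X i -` A \<inter> space M))"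
    using indep I(2,1) A by (rule indep_varsD_finite)
  finally obtain i where i: "i \<in> I" "prob (X i -` A \<inter> space M) = 0"
    using I by (auto simp: prod_zero_iff)
  then have "emeasure (distr M L (X i)) A = 0"
    using rv A by (simp add: emeasure_distr emeasure_eq_measure)
  with law[OF i(1)] A show ?thesis by (auto simp: null_sets_def)
qed

section \<open>Coverage under a change of law at one point\<close>

lemma below_quantile_reindex:
  assumes "bij_betw t J K" and "i \<in> J"
  shows "below_quantile \<alpha> (\<lambda>l. w (t l)) (\<lambda>l. s (t l)) J i \<longleftrightarrow> below_quantile \<alpha> w s K (t i)"
proof -
  have inj: "inj_on t J" and img: "t ` J = K" using assms(1) by (simp_all add: bij_betw_def)
  have "t ` (J - {i}) = K - {t i}"
    using inj_on_image_set_diff[OF inj, of J "{i}"] \<open>i \<in> J\<close> img by simp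
  then have bij: "bij_betw t (J - {i}) (K - {t i})"
    using inj_on_subset[OF inj, of "J - {i}"] by (simp add: bij_betw_def)
  show ?thesis
    unfolding below_quantile_def
    using sum.reindex_bij_betw[OF bij, of w]
      sum.reindex_bij_betw[OF assms(1), of "\<lambda>l. w l * of_bool (s l < s (t i))"]
    by (simp only:)
qed

lemma below_quantile_cong:
  assumes "\<And>l. l \<in> J \<Longrightarrow> w l = w' l" "\<And>l. l \<in> J \<Longrightarrow> s l = s' l" "i \<in> J"
  shows "below_quantile \<alpha> w s J i \<longleftrightarrow> below_quantile \<alpha> w' s' J i"
proof -
  have "sum w (J - {i}) = sum w' (J - {i})" using assms by (intro sum.cong) auto
  then show ?thesis using assms by (simp add: below_quantile_def cong: sum.cong)
qed

lemma measurable_below_quantile: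
  fixes S :: "'b \<Rightarrow> ereal"
  assumes S: "S \<in> borel_measurable N" and w: "w \<in> borel_measurable N" and "i \<in> J"
  shows "Measurable.pred (Pi\<^sub>M J (\<lambda>_. N)) (\<lambda>x. below_quantile \<alpha> (\<lambda>l. w (x l)) (\<lambda>l. S (x l)) J i)"
proof -
  have S': "(\<lambda>x. S (x l)) \<in> borel_measurable (Pi\<^sub>M J (\<lambda>_. N))"
    and w': "(\<lambda>x. w (x l)) \<in> borel_measurable (Pi\<^sub>M J (\<lambda>_. N))" if "l \<in> J" for l
    by (rule measurable_compose[OF measurable_component_singleton[OF that] S],
        rule measurable_compose[OF measurable_component_singleton[OF that] w])
  have below: "(\<lambda>x. of_bool (S (x l) < S (x i)) :: real) \<in> borel_measurable (Pi\<^sub>M J (\<lambda>_. N))" if "l \<in> J" for l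
    using borel_measurable_pred_less[OF S'[OF that] S'[OF \<open>i \<in> J\<close>]] by measurable
  show ?thesis
    unfolding below_quantile_def
    by (intro borel_measurable_pred_less borel_measurable_sum borel_measurable_times
        borel_measurable_const w' below) auto
qed

text \<open>
  Let \<open>u j\<close> be the weight of point \<open>j\<close> if that point is below the quantile of the others, and 0
  if it is not. Under the product law with all factors \<open>N\<close>, each \<open>u j\<close> has the coverage
  probability as its expectation: for \<open>i\<close> by the change of law, for the other indices by
  exchanging them with \<open>i\<close>. In the same way each weight has expectation 1. Hence the mean of the sum
  of all \<open>u j\<close> minus \<open>\<alpha>\<close> times the total weight is \<open>card J\<close> times the coverage error, and pointwise
  this difference is at most \<open>b\<close>.
\<close>

lemma weighted_conformal_coverage:
  fixes w :: "'b \<Rightarrow> real" and S :: "'b \<Rightarrow> ereal"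
  assumes N: "prob_space N" and fin: "finite J" and i: "i \<in> J"
    and w: "w \<in> borel_measurable N" and bound: "\<And>x. 0 \<le> w x \<and> w x \<le> b"
    and Q: "prob_space (density N (\<lambda>x. ennreal (w x)))"
    and S: "S \<in> borel_measurable N" and atomless: "\<And>t. AE x in N. S x \<noteq> t"
    and \<alpha>: "0 \<le> \<alpha>" "\<alpha> \<le> 1"
  shows "\<bar>measure (Pi\<^sub>M J (\<lambda>j. if j = i then density N (\<lambda>x. ennreal (w x)) else N))
      {x \<in> space (Pi\<^sub>M J (\<lambda>_. N)). below_quantile \<alpha> (\<lambda>l. w (x l)) (\<lambda>l. S (x l)) J i} - \<alpha>\<bar>
    \<le> b / card J"
proof -
  interpret N: prob_space N by fact
  let ?P = "Pi\<^sub>M J (\<lambda>_. N)"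
  let ?L = "Pi\<^sub>M J (\<lambda>j. if j = i then density N (\<lambda>x. ennreal (w x)) else N)"
  let ?B = "\<lambda>x. below_quantile \<alpha> (\<lambda>l. w (x l)) (\<lambda>l. S (x l)) J"
  let ?E = "{x \<in> space ?P. ?B x i}"
  define u where "u j x = w (x j) * of_bool (?B x j)" for j x
  interpret P: prob_space ?P by (intro prob_space_PiM N)
  interpret L: prob_space ?L using Q N by (intro prob_space_PiM) simp
  have b: "0 \<le> b" using bound[of undefined] by linarith
  have wm[measurable]: "(\<lambda>x. w (x j)) \<in> borel_measurable ?P" if "j \<in> J" for j
    using measurable_compose[OF measurable_component_singleton[OF that] w] by simp
  have Bm[measurable]: "Measurable.pred ?P (\<lambda>x. ?B x j)" if "j \<in> J" for j
    using S w that by (rule measurable_below_quantile)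
  have um: "u j \<in> borel_measurable ?P" if "j \<in> J" for j
    unfolding u_def using that by measurable
  have int_w: "integrable ?P (\<lambda>x. w (x j))" if "j \<in> J" for j
    using bound that by (intro P.integrable_const_bound[of _ b]) auto
  have int_u: "integrable ?P (u j)" if "j \<in> J" for j
    using bound b um[OF that] by (intro P.integrable_const_bound[of _ b]) (auto simp: u_def)
  have law: "measure ?L E = (\<integral>x. w (x i) * indicator E x \<partial>?P)" if "E \<in> sets ?P" for E
  proof -
    have "measure ?L E = enn2real (\<integral>\<^sup>+ x. ennreal (w (x i) * indicator E x) \<partial>?P)"
      unfolding measure_def emeasure_PiM_change_one[OF N w Q fin i that]
      by (intro arg_cong[where f = enn2real] nn_integral_cong) (auto simp: indicator_def)
    also have "\<dots> = (\<integral>x. w (x i) * indicator E x \<partial>?P)"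
      using i that bound by (intro integral_eq_nn_integral[symmetric]) auto
    finally show ?thesis .
  qed
  have space_L: "space ?L = space ?P"
    by (intro sets_eq_imp_space_eq sets_PiM_cong) auto
  have E: "?E \<in> sets ?P" using i by measurable
  \<comment> \<open>The law formula for the whole space says that the weight has mean 1.\<close>
  have "(\<integral>x. w (x i) \<partial>?P) = (\<integral>x. w (x i) * indicator (space ?P) x \<partial>?P)"
    by (intro Bochner_Integration.integral_cong) auto
  also have "\<dots> = measure ?L (space ?L)"
    using law[OF sets.top] space_L by simp
  finally have int_w_i: "(\<integral>x. w (x i) \<partial>?P) = 1" using L.prob_space by simp
  have prob_E: "measure ?L ?E = (\<integral>x. u i x \<partial>?P)"
    unfolding law[OF E] by (intro Bochner_Integration.integral_cong) (auto simp: u_def)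
  have sym: "(\<integral>x. w (x j) \<partial>?P) = 1" "(\<integral>x. u j x \<partial>?P) = measure ?L ?E" if j: "j \<in> J" for j
  proof -
    let ?t = "Transposition.transpose i j"
    let ?r = "\<lambda>x. \<lambda>l\<in>J. x (?t l)"
    have bij: "bij_betw ?t J J"
      using i j by (intro bij_betw_byWitness[where f' = ?t]) (auto simp: Transposition.transpose_def)
    have "(\<integral>x. w (x j) \<partial>?P) = (\<integral>x. w (?r x i) \<partial>?P)" using i by simp
    also have "\<dots> = (\<integral>x. w (x i) \<partial>?P)"
      using wm[OF i] by (rule integral_PiM_transpose[OF N i j])
    finally show "(\<integral>x. w (x j) \<partial>?P) = 1" using int_w_i by simp
    have "?B (?r x) i = ?B x j" for x
      using below_quantile_reindex[OF bij i, of \<alpha> "\<lambda>l. w (x l)" "\<lambda>l. S (x l)"]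
        below_quantile_cong[of J "\<lambda>l. w (?r x l)" "\<lambda>l. w (x (?t l))" "\<lambda>l. S (?r x l)" "\<lambda>l. S (x (?t l))" i \<alpha>] i
      by simp
    then have "(\<integral>x. u j x \<partial>?P) = (\<integral>x. u i (?r x) \<partial>?P)" using i by (simp add: u_def)
    also have "\<dots> = measure ?L ?E"
      unfolding prob_E using um[OF i] by (rule integral_PiM_transpose[OF N i j])
    finally show "(\<integral>x. u j x \<partial>?P) = measure ?L ?E" .
  qed
  let ?d = "\<lambda>x. (\<Sum>j\<in>J. u j x) - \<alpha> * (\<Sum>j\<in>J. w (x j))"
  have int_d: "integrable ?P ?d" using int_u int_w by auto
  have "(\<integral>x. ?d x \<partial>?P) = card J * (measure ?L ?E - \<alpha>)"
    using int_u int_w sym by (simp add: Bochner_Integration.integral_sum algebra_simps)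
  moreover have "\<bar>\<integral>x. ?d x \<partial>?P\<bar> \<le> b"
  proof -
    have "AE x in ?P. \<bar>?d x\<bar> \<le> b"
      using AE_PiM_inj_on[OF N fin S atomless]
    proof eventually_elim
      case (elim x)
      show ?case unfolding u_def
        by (rule below_quantile_total_weight) (use fin bound b elim \<alpha> in auto)
    qed
    then have "(\<integral>x. \<bar>?d x\<bar> \<partial>?P) \<le> (\<integral>x. b \<partial>?P)"
      using int_d by (intro integral_mono_AE) auto
    also have "\<dots> = b" by (simp add: P.prob_space)
    finally show ?thesis by (rule order_trans[OF integral_abs_bound])
  qed
  ultimately have "card J * \<bar>measure ?L ?E - \<alpha>\<bar> \<le> b" by (simp add: abs_mult)
  moreover have "0 < card J" using fin i by (auto simp: card_gt_0_iff)
  ultimately show ?thesis by (simp add: field_simps)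
qed

section \<open>The least threshold that reaches a given weight\<close>

text \<open>
  The weight of the scores up to \<open>\<eta>\<close> is a right continuous step function of \<open>\<eta>\<close>, so the feasible
  scales are closed within the positive reals. They have a minimum unless there is none
  of them or all positive reals are feasible, when the infimum is 0 and not attained. Both
  exceptions are conditions on finite sums of the sample, which makes the existence of a minimum a
  measurable event.
\<close>

lemma least_threshold_exists_iff:
  fixes w :: "'i \<Rightarrow> real" and s :: "'i \<Rightarrow> ereal"
  assumes fin: "finite I" and w: "\<And>i. i \<in> I \<Longrightarrow> 0 \<le> w i" and s: "\<And>i. i \<in> I \<Longrightarrow> 0 \<le> s i" and V: "0 < V"
  defines "feasible \<equiv> \<lambda>\<eta>::real. 0 < \<eta> \<and> V \<le> (\<Sum>i\<in>I. w i * of_bool (s i \<le> ereal \<eta>))"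
  shows "(\<exists>\<eta>. feasible \<eta> \<and> (\<forall>\<eta>'. feasible \<eta>' \<longrightarrow> \<eta> \<le> \<eta>')) \<longleftrightarrow>
    (\<Sum>i\<in>I. w i * of_bool (s i \<le> 0)) < V \<and> V \<le> (\<Sum>i\<in>I. w i * of_bool (s i < \<infinity>))"
proof -
  let ?m = "\<lambda>P. \<Sum>i\<in>I. w i * of_bool (P (s i))"
  have mono: "?m P \<le> ?m P'" if "\<And>i. i \<in> I \<Longrightarrow> P (s i) \<Longrightarrow> P' (s i)" for P P' :: "ereal \<Rightarrow> bool"
    using that w by (intro sum_mono) auto
  \<comment> \<open>The index with the largest score among those satisfying P already collects the weight V.\<close>
  have top: "\<exists>j\<in>I. P (s j) \<and> V \<le> ?m (\<lambda>a. a \<le> s j)" if "V \<le> ?m P" for P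
  proof -
    let ?A = "{i\<in>I. P (s i)}"
    have "?A \<noteq> {}"
    proof
      assume "?A = {}"
      then have "?m P = 0" by (intro sum.neutral) auto
      with that V show False by simp
    qed
    then obtain j where j: "j \<in> ?A" "\<And>l. l \<in> ?A \<Longrightarrow> s l \<le> s j"
      using fin obtains_MAX[of ?A s] by (metis (no_types, lifting) Max_ge finite_imageI finite_subset imageI mem_Collect_eq subsetI)
    then have "?m P \<le> ?m (\<lambda>a. a \<le> s j)" by (intro mono) auto
    with that j(1) show ?thesis by auto
  qed
  show ?thesis
  proof
    assume "\<exists>\<eta>. feasible \<eta> \<and> (\<forall>\<eta>'. feasible \<eta>' \<longrightarrow> \<eta> \<le> \<eta>')"
    then obtain \<eta> where \<eta>: "feasible \<eta>" "\<And>\<eta>'. feasible \<eta>' \<Longrightarrow> \<eta> \<le> \<eta>'" by blast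
    have "?m (\<lambda>a. a \<le> ereal \<eta>) \<le> ?m (\<lambda>a. a < \<infinity>)" by (intro mono) auto
    moreover have "?m (\<lambda>a. a \<le> 0) < V"
    proof (rule ccontr)
      assume "\<not> ?m (\<lambda>a. a \<le> 0) < V"
      moreover have "?m (\<lambda>a. a \<le> 0) \<le> ?m (\<lambda>a. a \<le> ereal (\<eta> / 2))"
        using \<eta>(1) by (intro mono) (auto simp: feasible_def intro: order_trans)
      ultimately have "feasible (\<eta> / 2)" using \<eta>(1) by (simp add: feasible_def)
      from \<eta>(2)[OF this] \<eta>(1) show False by (simp add: feasible_def)
    qed
    ultimately show "?m (\<lambda>a. a \<le> 0) < V \<and> V \<le> ?m (\<lambda>a. a < \<infinity>)"
      using \<eta>(1) by (auto simp: feasible_def)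
  next
    assume *: "?m (\<lambda>a. a \<le> 0) < V \<and> V \<le> ?m (\<lambda>a. a < \<infinity>)"
    let ?C = "{j\<in>I. s j < \<infinity> \<and> V \<le> ?m (\<lambda>a. a \<le> s j)}"
    have "?C \<noteq> {}" using top[of "\<lambda>a. a < \<infinity>"] * by auto
    then obtain k where k: "k \<in> ?C" "\<And>l. l \<in> ?C \<Longrightarrow> s k \<le> s l"
      using fin obtains_MIN[of ?C s] by (metis (no_types, lifting) Min_le finite_imageI finite_subset imageI mem_Collect_eq subsetI)
    obtain \<eta> where \<eta>: "s k = ereal \<eta>" using k(1) s[of k] by (cases "s k") auto
    have "\<eta> \<noteq> 0" using k(1) * \<eta> by (auto simp: zero_ereal_def)
    then have "feasible \<eta>" using k(1) s[of k] by (auto simp: feasible_def \<eta>)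
    moreover have "\<eta> \<le> \<eta>'" if "feasible \<eta>'" for \<eta>'
    proof -
      have "V \<le> ?m (\<lambda>a. a \<le> ereal \<eta>')" using that by (simp add: feasible_def)
      from top[OF this] obtain j where j: "j \<in> I" "s j \<le> ereal \<eta>'" "V \<le> ?m (\<lambda>a. a \<le> s j)" by auto
      have "s k \<le> s j" using j by (intro k(2)) auto
      then show ?thesis using j \<eta> by (metis ereal_less_eq(3) order_trans)
    qed
    ultimately show "\<exists>\<eta>. feasible \<eta> \<and> (\<forall>\<eta>'. feasible \<eta>' \<longrightarrow> \<eta> \<le> \<eta>')" by blast
  qed
qed

text \<open>
  If the scores below \<open>t \<le> \<eta>\<close> already had weight \<open>V\<close>, then so would the scores up to some
  \<open>r < \<eta>\<close>, because finitely many scores leave a gap below \<open>t\<close>. This contradicts minimality of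
  \<open>\<eta>\<close>.
\<close>

lemma le_least_threshold_iff:
  fixes w :: "'i \<Rightarrow> real" and s :: "'i \<Rightarrow> ereal"
  assumes fin: "finite I" and w: "\<And>i. i \<in> I \<Longrightarrow> 0 \<le> w i" and s: "\<And>i. i \<in> I \<Longrightarrow> 0 \<le> s i" and V: "0 < V"
  assumes \<eta>: "0 < \<eta>" "V \<le> (\<Sum>i\<in>I. w i * of_bool (s i \<le> ereal \<eta>))"
    and least: "\<And>\<eta>'. 0 < \<eta>' \<Longrightarrow> V \<le> (\<Sum>i\<in>I. w i * of_bool (s i \<le> ereal \<eta>')) \<Longrightarrow> \<eta> \<le> \<eta>'"
  shows "t \<le> ereal \<eta> \<longleftrightarrow> (\<Sum>i\<in>I. w i * of_bool (s i < t)) < V"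
proof
  assume t: "t \<le> ereal \<eta>"
  show "(\<Sum>i\<in>I. w i * of_bool (s i < t)) < V"
  proof (rule ccontr)
    assume *: "\<not> (\<Sum>i\<in>I. w i * of_bool (s i < t)) < V"
    \<comment> \<open>Including 0 keeps the scale r, found between this maximum and \<eta>, positive.\<close>
    let ?m = "Max (insert 0 (s ` {i\<in>I. s i < t}))"
    have "\<exists>i\<in>I. s i < t"
    proof (rule ccontr)
      assume "\<not> (\<exists>i\<in>I. s i < t)"
      then have "(\<Sum>i\<in>I. w i * of_bool (s i < t)) = 0" by (intro sum.neutral) auto
      with * V show False by simp
    qed
    then have "0 < t" using s by (metis le_less_trans)
    then have "?m < t" using fin by (subst Max_less_iff) auto
    then have "?m < ereal \<eta>" using t by simp
    then obtain r where r: "?m < ereal r" "ereal r < ereal \<eta>" using ereal_dense2 by blast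
    have "0 \<le> ?m" using fin by (intro Max_ge) auto
    from le_less_trans[OF this r(1)] have "0 < ereal r" .
    have "s i \<le> ereal r" if "i \<in> I" "s i < t" for i
    proof -
      have "s i \<le> ?m" using fin that by (intro Max_ge) auto
      with r(1) show ?thesis by simp
    qed
    then have "(\<Sum>i\<in>I. w i * of_bool (s i < t)) \<le> (\<Sum>i\<in>I. w i * of_bool (s i \<le> ereal r))"
      using w by (intro sum_mono) auto
    with * \<open>0 < ereal r\<close> have "\<eta> \<le> r" by (intro least) auto
    with r(2) show False by simp
  qed
next
  assume *: "(\<Sum>i\<in>I. w i * of_bool (s i < t)) < V"
  show "t \<le> ereal \<eta>"
  proof (rule ccontr)
    assume "\<not> t \<le> ereal \<eta>"
    then have "(\<Sum>i\<in>I. w i * of_bool (s i \<le> ereal \<eta>)) \<le> (\<Sum>i\<in>I. w i * of_bool (s i < t))"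
      using w by (intro sum_mono) auto
    with * \<eta>(2) show False by simp
  qed
qed

section \<open>The score of a data point for a scaled box\<close>

text \<open>
  The learned width may be zero or negative. A negative width makes the box empty in this coordinate
  at every positive scale, and a zero width admits only a residual of zero, for which the
  quotient below is \<open>0 / 0 = 0\<close>, as wanted.
\<close>

definition score_component ::
  "(real ^ 'd \<Rightarrow> real ^ 'n) \<Rightarrow> (real ^ 'd \<Rightarrow> real ^ 'n) \<Rightarrow> ('n, 'd) point \<Rightarrow> 'n \<Rightarrow> ereal" where
  "score_component f h x k =
     (let r = \<bar>fst x $ k - f (snd x) $ k\<bar>; a = h (snd x) $ k in
      if a < 0 \<or> (a = 0 \<and> r \<noteq> 0) then \<infinity> else ereal (r / a))"

definition score ::
  "(real ^ 'd \<Rightarrow> real ^ 'n) \<Rightarrow> (real ^ 'd \<Rightarrow> real ^ 'n) \<Rightarrow> ('n, 'd) point \<Rightarrow> ereal" where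
  "score f h x = (SUP k. score_component f h x k)"

lemma score_nonneg: "0 \<le> score f h x"
  unfolding score_def
  by (rule SUP_upper2[where i = undefined]) (auto simp: score_component_def Let_def)

lemma mem_pred_box_iff_score_le:
  assumes "0 < \<eta>"
  shows "fst x \<in> pred_box f h \<eta> (snd x) \<longleftrightarrow> score f h x \<le> ereal \<eta>"
proof -
  have "score_component f h x k \<le> ereal \<eta> \<longleftrightarrow> \<bar>fst x $ k - f (snd x) $ k\<bar> \<le> \<eta> * h (snd x) $ k" for k
    using assms mult_pos_neg[OF assms, of "h (snd x) $ k"]
    by (auto simp: score_component_def Let_def field_simps)
  then have "score f h x \<le> ereal \<eta> \<longleftrightarrow> (\<forall>k. \<bar>fst x $ k - f (snd x) $ k\<bar> \<le> \<eta> * h (snd x) $ k)"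
    by (simp add: score_def SUP_le_iff)
  also have "\<dots> \<longleftrightarrow> fst x \<in> pred_box f h \<eta> (snd x)"
    by (auto simp: pred_box_def less_eq_vec_def abs_le_iff algebra_simps)
  finally show ?thesis by simp
qed

lemma borel_measurable_component:
  assumes "g \<in> borel_measurable N"
  shows "(\<lambda>x. (g x :: real ^ 'n) $ k) \<in> borel_measurable N"
  by (rule borel_measurable_continuous_on[OF _ assms, of "\<lambda>v. v $ k"]) (intro continuous_intros)

lemma borel_measurable_score:
  fixes f h :: "real ^ 'd \<Rightarrow> real ^ 'n"
  assumes f: "f \<in> borel_measurable borel" and h: "h \<in> borel_measurable borel"
  shows "score f h \<in> borel_measurable borel"
proof -
  have [measurable]: "(\<lambda>x :: (real ^ 'n) \<times> (real ^ 'd). fst x $ k) \<in> borel_measurable borel"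
    "(\<lambda>x :: (real ^ 'n) \<times> (real ^ 'd). f (snd x) $ k) \<in> borel_measurable borel"
    "(\<lambda>x :: (real ^ 'n) \<times> (real ^ 'd). h (snd x) $ k) \<in> borel_measurable borel" for k
    by (intro borel_measurable_component measurable_compose[OF _ f] measurable_compose[OF _ h]
        borel_measurable_continuous_onI continuous_intros)+
  show ?thesis
    unfolding score_def score_component_def Let_def by measurable
qed

lemma AE_lborel_component_neq:
  "AE c in lborel. (c :: real ^ 'n) $ k \<noteq> a"
proof -
  have "closed {c :: real ^ 'n. c $ k = a}"
    by (intro closed_Collect_eq continuous_intros)
  then have "{c :: real ^ 'n. c $ k = a} \<in> sets lborel" by simp
  moreover have "negligible {c :: real ^ 'n. c $ k = a}"
    using negligible_standard_hyperplane[of "axis k 1 :: real ^ 'n" a]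
    by (simp add: cart_eq_inner_axis Basis_real_def axis_in_Basis_iff)
  ultimately have "{c :: real ^ 'n. c $ k = a} \<in> null_sets lborel"
    by (simp only: negligible_iff_null_sets null_sets_completion_iff)
  from AE_not_in[OF this] show ?thesis by simp
qed

text \<open>
  By Fubini it suffices that, for a fixed second component, a coordinate hyperplane is a null set.
\<close>

lemma AE_lborel_neq_graph:
  fixes g :: "real ^ 'd \<Rightarrow> real"
  assumes g: "g \<in> borel_measurable borel"
  shows "AE x in lborel. fst (x :: (real ^ 'n) \<times> (real ^ 'd)) $ k \<noteq> g (snd x)"
proof -
  have [measurable]: "(\<lambda>x :: (real ^ 'n) \<times> (real ^ 'd). fst x $ k) \<in> borel_measurable (lborel \<Otimes>\<^sub>M lborel)"
    "(\<lambda>x :: (real ^ 'n) \<times> (real ^ 'd). g (snd x)) \<in> borel_measurable (lborel \<Otimes>\<^sub>M lborel)"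
    using g by (intro borel_measurable_component measurable_compose[OF _ g]; simp)+
  have sets: "{x \<in> space (lborel \<Otimes>\<^sub>M lborel). fst (x :: (real ^ 'n) \<times> (real ^ 'd)) $ k \<noteq> g (snd x)}
    \<in> sets (lborel \<Otimes>\<^sub>M lborel)" by measurable
  have "AE z in lborel. AE c in lborel. (c :: real ^ 'n) $ k \<noteq> g z"
    by (simp add: AE_lborel_component_neq)
  then have "AE c in lborel. AE z in lborel. (c :: real ^ 'n) $ k \<noteq> g z"
    by (subst lborel_pair.AE_commute[OF sets])
  with sets have "AE x in lborel \<Otimes>\<^sub>M lborel. fst (x :: (real ^ 'n) \<times> (real ^ 'd)) $ k \<noteq> g (snd x)"
    by (intro lborel_pair.AE_pair_measure) auto
  then show ?thesis unfolding lborel_prod .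
qed

text \<open>
  The supremum over the finitely many coordinates is attained, so a finite score \<open>\<tau>\<close> forces
  \<open>c\<^sub>k = f\<^sub>k(z) + \<tau> h\<^sub>k(z)\<close> or \<open>c\<^sub>k = f\<^sub>k(z) - \<tau> h\<^sub>k(z)\<close> for some \<open>k\<close>, and each of these sets is
  a graph over \<open>z\<close>.
\<close>

lemma AE_lborel_score_neq:
  fixes f h :: "real ^ 'd \<Rightarrow> real ^ 'n"
  assumes f: "f \<in> borel_measurable borel" and h: "h \<in> borel_measurable borel" and "t \<noteq> \<infinity>"
  shows "AE x in lborel. score f h (x :: (real ^ 'n) \<times> (real ^ 'd)) \<noteq> t"
proof -
  note [measurable] = borel_measurable_component[OF f] borel_measurable_component[OF h]
  let ?g = "\<lambda>\<sigma> k z. f z $ k + \<sigma> * real_of_ereal t * h z $ k"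
  have "AE x in lborel. \<forall>k. fst (x :: (real ^ 'n) \<times> (real ^ 'd)) $ k \<noteq> ?g 1 k (snd x)
      \<and> fst x $ k \<noteq> ?g (-1) k (snd x)"
    unfolding AE_all_countable by (intro allI AE_conjI AE_lborel_neq_graph) measurable
  then show ?thesis
  proof eventually_elim
    case (elim x)
    show ?case
    proof
      assume t: "score f h x = t"
      obtain \<tau> where \<tau>: "t = ereal \<tau>"
        using \<open>t \<noteq> \<infinity>\<close> score_nonneg[of f h x] t by (cases t) auto
      have "score f h x \<in> range (score_component f h x)"
        unfolding score_def by (subst cSup_eq_Max) (auto intro!: Max_in)
      then obtain k where k: "score_component f h x k = ereal \<tau>" using t \<tau> by auto
      then have "\<bar>fst x $ k - f (snd x) $ k\<bar> = \<tau> * h (snd x) $ k"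
        by (auto simp: score_component_def Let_def split: if_splits)
      then have "fst x $ k = ?g 1 k (snd x) \<or> fst x $ k = ?g (-1) k (snd x)"
        by (auto simp: \<tau> abs_if split: if_splits)
      with elim show False by blast
    qed
  qed
qed

section \<open>The boxes of the algorithm in terms of scores\<close>

lemma feasible_scale_iff:
  assumes "finite I" "I \<noteq> {}" "\<And>x. 0 < w x"
  shows "feasible_scale f h w \<alpha> I D \<eta> \<longleftrightarrow> 0 < \<eta> \<and>
    \<alpha> * (\<Sum>i\<in>I. w (D i)) \<le> (\<Sum>i\<in>I. w (D i) * of_bool (score f h (D i) \<le> ereal \<eta>))"
proof -
  have "0 < (\<Sum>i\<in>I. w (D i))" using assms by (intro sum_pos) auto
  then show ?thesis
    by (auto simp: feasible_scale_def weighted_coverage_def mem_pred_box_iff_score_le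
        sum_divide_distrib[symmetric] pos_le_divide_eq)
qed

lemma minimal_scale_exists_iff:
  assumes I: "finite I" "I \<noteq> {}" and w: "\<And>x. 0 < w x" and "0 < \<alpha>"
  shows "minimal_scale_exists f h w \<alpha> I D \<longleftrightarrow>
    (\<Sum>i\<in>I. w (D i) * of_bool (score f h (D i) \<le> 0)) < \<alpha> * (\<Sum>i\<in>I. w (D i)) \<and>
    \<alpha> * (\<Sum>i\<in>I. w (D i)) \<le> (\<Sum>i\<in>I. w (D i) * of_bool (score f h (D i) < \<infinity>))"
proof -
  have "0 < \<alpha> * (\<Sum>i\<in>I. w (D i))" using assms by (intro mult_pos_pos sum_pos) auto
  then show ?thesis
    unfolding minimal_scale_exists_def feasible_scale_iff[OF I w]
    by (intro least_threshold_exists_iff I(1) score_nonneg less_imp_le[OF w])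
qed

text \<open>
  The scale itself is eliminated: coverage becomes a comparison of the score of the new point with
  the scores of the sample.
\<close>

lemma mem_ood_ro_set_iff:
  assumes I: "finite I" "I \<noteq> {}" and w: "\<And>x. 0 < w x" and "0 < \<alpha>"
    and "minimal_scale_exists f h w \<alpha> I D"
  shows "fst x \<in> ood_ro_set f h w \<alpha> I D (snd x) \<longleftrightarrow>
    (\<Sum>i\<in>I. w (D i) * of_bool (score f h (D i) < score f h x)) < \<alpha> * (\<Sum>i\<in>I. w (D i))"
proof -
  note feasible = feasible_scale_iff[OF I w]
  have pos: "0 < \<alpha> * (\<Sum>i\<in>I. w (D i))" using assms by (intro mult_pos_pos sum_pos) auto
  obtain \<eta> where \<eta>: "feasible_scale f h w \<alpha> I D \<eta>"
    and least: "\<And>\<eta>'. feasible_scale f h w \<alpha> I D \<eta>' \<Longrightarrow> \<eta> \<le> \<eta>'"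
    using assms(5) unfolding minimal_scale_exists_def by blast
  have "0 < \<eta>" using \<eta> by (simp add: feasible_scale_def)
  have "ood_ro_scale f h w \<alpha> I D = \<eta>"
    unfolding ood_ro_scale_def using \<eta> least by (rule Least_equality)
  then have "fst x \<in> ood_ro_set f h w \<alpha> I D (snd x) \<longleftrightarrow> score f h x \<le> ereal \<eta>"
    using mem_pred_box_iff_score_le[OF \<open>0 < \<eta>\<close>] by (simp add: ood_ro_set_def)
  also have "\<dots> \<longleftrightarrow> (\<Sum>i\<in>I. w (D i) * of_bool (score f h (D i) < score f h x)) < \<alpha> * (\<Sum>i\<in>I. w (D i))"
  proof (rule le_least_threshold_iff)
    show "\<alpha> * (\<Sum>i\<in>I. w (D i)) \<le> (\<Sum>i\<in>I. w (D i) * of_bool (score f h (D i) \<le> ereal \<eta>))"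
      using \<eta> unfolding feasible by simp
    show "\<eta> \<le> \<eta>'" if "0 < \<eta>'"
      "\<alpha> * (\<Sum>i\<in>I. w (D i)) \<le> (\<Sum>i\<in>I. w (D i) * of_bool (score f h (D i) \<le> ereal \<eta>'))" for \<eta>'
      using least that unfolding feasible by simp
  qed (rule I score_nonneg less_imp_le[OF w] pos \<open>0 < \<eta>\<close>)+
  finally show ?thesis .
qed

text \<open>
  If there is no minimum, \<^const>\<open>Least\<close> picks an element of the empty predicate, the same one for all
  samples. This makes the coverage event measurable even off the almost sure event on which the
  algorithm is well defined.
\<close>

lemma ood_ro_set_no_minimal_scale:
  assumes "\<not> minimal_scale_exists f h w \<alpha> I D"
  shows "ood_ro_set f h w \<alpha> I D = pred_box f h (THE \<eta>. False)"
proof -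
  have "(\<lambda>\<eta>. feasible_scale f h w \<alpha> I D \<eta> \<and>
      (\<forall>\<eta>'. feasible_scale f h w \<alpha> I D \<eta>' \<longrightarrow> \<eta> \<le> \<eta>')) = (\<lambda>\<eta>. False)"
    using assms by (auto simp: minimal_scale_exists_def fun_eq_iff)
  then show ?thesis by (simp add: ood_ro_set_def ood_ro_scale_def Least_def)
qed

lemma sets_mem_pred_box:
  assumes x: "x \<in> borel_measurable M" and f: "f \<in> borel_measurable borel" and h: "h \<in> borel_measurable borel"
  shows "{\<omega> \<in> space M. fst (x \<omega>) \<in> pred_box f h \<eta> (snd (x \<omega>))} \<in> sets M"
proof -
  have c: "(\<lambda>\<omega>. fst (x \<omega>)) \<in> borel_measurable M"
    by (rule measurable_compose[OF x borel_measurable_continuous_onI]) (simp add: continuous_on_fst)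
  have z: "(\<lambda>\<omega>. snd (x \<omega>)) \<in> borel_measurable M"
    by (rule measurable_compose[OF x borel_measurable_continuous_onI]) (simp add: continuous_on_snd)
  note [measurable] = borel_measurable_component[OF c]
    borel_measurable_component[OF measurable_compose[OF z f]]
    borel_measurable_component[OF measurable_compose[OF z h]]
  have "{\<omega> \<in> space M. fst (x \<omega>) \<in> pred_box f h \<eta> (snd (x \<omega>))} = {\<omega> \<in> space M. \<forall>k.
      f (snd (x \<omega>)) $ k - \<eta> * h (snd (x \<omega>)) $ k \<le> fst (x \<omega>) $ k \<and>
      fst (x \<omega>) $ k \<le> f (snd (x \<omega>)) $ k + \<eta> * h (snd (x \<omega>)) $ k}"
    by (auto simp: pred_box_def less_eq_vec_def)
  also have "\<dots> \<in> sets M" by measurable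
  finally show ?thesis .
qed

text \<open>
  Measurability has to be proved on the whole space: the underlying probability space need not be
  complete, so the exceptional null set on which no minimal scale exists cannot be ignored.
\<close>

lemma sets_mem_ood_ro_set:
  assumes I: "finite I" "I \<noteq> {}" and w: "\<And>x. 0 < w x" and "0 < \<alpha>"
    and D: "\<And>i. i \<in> I \<Longrightarrow> D i \<in> borel_measurable M" and x: "x \<in> borel_measurable M"
    and f: "f \<in> borel_measurable borel" and h: "h \<in> borel_measurable borel"
    and w_meas: "w \<in> borel_measurable borel"
  shows "{\<omega> \<in> space M. fst (x \<omega>) \<in> ood_ro_set f h w \<alpha> I (\<lambda>i. D i \<omega>) (snd (x \<omega>))} \<in> sets M"
proof -
  note S = borel_measurable_score[OF f h]
  let ?m = "\<lambda>P \<omega>. \<Sum>i\<in>I. w (D i \<omega>) * of_bool (P (score f h (D i \<omega>)) \<omega>)"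
  let ?V = "\<lambda>\<omega>. \<alpha> * (\<Sum>i\<in>I. w (D i \<omega>))"
  let ?G = "{\<omega> \<in> space M. minimal_scale_exists f h w \<alpha> I (\<lambda>i. D i \<omega>)}"
  have SD: "(\<lambda>\<omega>. score f h (D i \<omega>)) \<in> borel_measurable M"
    and wD: "(\<lambda>\<omega>. w (D i \<omega>)) \<in> borel_measurable M" if "i \<in> I" for i
    using measurable_compose[OF D[OF that] S] measurable_compose[OF D[OF that] w_meas] .
  have Sx: "(\<lambda>\<omega>. score f h (x \<omega>)) \<in> borel_measurable M" by (rule measurable_compose[OF x S])
  have ind: "(\<lambda>\<omega>. of_bool (score f h (D i \<omega>) \<le> 0) :: real) \<in> borel_measurable M"
    "(\<lambda>\<omega>. of_bool (score f h (D i \<omega>) < \<infinity>) :: real) \<in> borel_measurable M"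
    "(\<lambda>\<omega>. of_bool (score f h (D i \<omega>) < score f h (x \<omega>)) :: real) \<in> borel_measurable M"
    if "i \<in> I" for i
  proof -
    note [measurable] = SD[OF that]
    show "(\<lambda>\<omega>. of_bool (score f h (D i \<omega>) \<le> 0) :: real) \<in> borel_measurable M" by measurable
    show "(\<lambda>\<omega>. of_bool (score f h (D i \<omega>) < \<infinity>) :: real) \<in> borel_measurable M" by measurable
    show "(\<lambda>\<omega>. of_bool (score f h (D i \<omega>) < score f h (x \<omega>)) :: real) \<in> borel_measurable M"
      using borel_measurable_pred_less[OF SD[OF that] Sx] by measurable
  qed
  have V: "?V \<in> borel_measurable M"
    by (intro borel_measurable_times borel_measurable_const borel_measurable_sum wD)
  have sums: "?m (\<lambda>s \<omega>. s \<le> 0) \<in> borel_measurable M" "?m (\<lambda>s \<omega>. s < \<infinity>) \<in> borel_measurable M"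
    "?m (\<lambda>s \<omega>. s < score f h (x \<omega>)) \<in> borel_measurable M"
    by (intro borel_measurable_times borel_measurable_sum wD ind; assumption)+
  have "?G = {\<omega> \<in> space M. ?m (\<lambda>s \<omega>. s \<le> 0) \<omega> < ?V \<omega>} \<inter> {\<omega> \<in> space M. ?V \<omega> \<le> ?m (\<lambda>s \<omega>. s < \<infinity>) \<omega>}"
    unfolding minimal_scale_exists_iff[OF I w \<open>0 < \<alpha>\<close>] by auto
  also have "\<dots> \<in> sets M"
    by (intro sets.Int borel_measurable_less borel_measurable_le sums V)
  finally have G: "?G \<in> sets M" .
  have "{\<omega> \<in> space M. fst (x \<omega>) \<in> ood_ro_set f h w \<alpha> I (\<lambda>i. D i \<omega>) (snd (x \<omega>))} =
      (?G \<inter> {\<omega> \<in> space M. ?m (\<lambda>s \<omega>. s < score f h (x \<omega>)) \<omega> < ?V \<omega>}) \<union>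
      ({\<omega> \<in> space M. fst (x \<omega>) \<in> pred_box f h (THE \<eta>. False) (snd (x \<omega>))} - ?G)"
  proof (intro set_eqI)
    fix \<omega>
    show "\<omega> \<in> {\<omega> \<in> space M. fst (x \<omega>) \<in> ood_ro_set f h w \<alpha> I (\<lambda>i. D i \<omega>) (snd (x \<omega>))} \<longleftrightarrow>
      \<omega> \<in> (?G \<inter> {\<omega> \<in> space M. ?m (\<lambda>s \<omega>. s < score f h (x \<omega>)) \<omega> < ?V \<omega>}) \<union>
      ({\<omega> \<in> space M. fst (x \<omega>) \<in> pred_box f h (THE \<eta>. False) (snd (x \<omega>))} - ?G)"
      using mem_ood_ro_set_iff[where w = w and f = f and h = h and D = "\<lambda>i. D i \<omega>" and x = "x \<omega>",
          OF I w \<open>0 < \<alpha>\<close>]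
        ood_ro_set_no_minimal_scale[where f = f and h = h and w = w and \<alpha> = \<alpha> and I = I and D = "\<lambda>i. D i \<omega>"]
      by (cases "minimal_scale_exists f h w \<alpha> I (\<lambda>i. D i \<omega>)") (auto simp del: sum_mult_of_bool_eq)
  qed
  also have "\<dots> \<in> sets M"
    using G borel_measurable_less[OF sums(3) V] sets_mem_pred_box[OF x f h]
    by (intro sets.Un sets.Int sets.Diff)
  finally show ?thesis .
qed

section \<open>The coverage bound\<close>

theorem theorem1:
  fixes M :: "'a measure"
    and p q w_hat :: "(real ^ 'n) \<times> (real ^ 'd) \<Rightarrow> real"
    and f_hat h_hat :: "real ^ 'd \<Rightarrow> real ^ 'n"
    and H :: "(real ^ 'd \<Rightarrow> real ^ 'n) set"
    and I1 I2 :: "'i set"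
    and D1 :: "'i \<Rightarrow> (real ^ 'n) \<times> (real ^ 'd)"
    and D2 :: "'i \<Rightarrow> 'a \<Rightarrow> (real ^ 'n) \<times> (real ^ 'd)"
    and c_new :: "'a \<Rightarrow> real ^ 'n"
    and z_new :: "'a \<Rightarrow> real ^ 'd"
    and \<alpha> w_lo w_up :: real
  assumes "prob_space M"
    and "0 < \<alpha>" and "\<alpha> < 1"
    \<comment> \<open>densities with respect to Lebesgue measure, with density ratio defined everywhere\<close>
    and "\<And>x. p x > 0" and "\<And>x. q x \<ge> 0"
    and "p \<in> borel_measurable borel" and "q \<in> borel_measurable borel"
    \<comment> \<open>index sets of the two parts of the training data; the first part is held fixed\<close>
    and "finite I1" and "finite I2" and "I1 \<inter> I2 = {}"
    \<comment> \<open>the second part is i.i.d. with density p and independent of the test point (index None)\<close>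
    and "prob_space.indep_vars M (\<lambda>_. borel)
           (case_option (\<lambda>\<omega>. (c_new \<omega>, z_new \<omega>)) D2) (insert None (Some ` I2))"
    and "\<And>i. i \<in> I2 \<Longrightarrow> distributed M lborel (D2 i) (\<lambda>x. ennreal (p x))"
    and "distributed M lborel (\<lambda>\<omega>. (c_new \<omega>, z_new \<omega>)) (\<lambda>x. ennreal (q x))"
    and "f_hat \<in> borel_measurable borel" and "h_hat \<in> borel_measurable borel"
    and "w_hat \<in> borel_measurable borel"
    and "quantile_regression_fit \<alpha> f_hat I1 D1 H h_hat"
    and "AE \<omega> in M. minimal_scale_exists f_hat h_hat w_hat \<alpha> I2 (\<lambda>i. D2 i \<omega>)"
    and "w_lo > 0" and "w_up > 0"
    and "\<And>x. w_lo \<le> w_hat x \<and> w_hat x \<le> w_up"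
    and "\<And>x. w_hat x = q x / p x"
  shows "\<bar>measure M {\<omega> \<in> space M.
             c_new \<omega> \<in> ood_ro_set f_hat h_hat w_hat \<alpha> I2 (\<lambda>i. D2 i \<omega>) (z_new \<omega>)} - \<alpha>\<bar>
         \<le> 1 / (real (card I2) + 1) * (w_up / w_lo)"
proof -
  interpret M: prob_space M by fact
  note \<alpha> = assms(2,3) and p_pos = assms(4) and p_meas = assms(6)
    and fin = assms(9) and indep = assms(11) and D2 = assms(12)
    and new = assms(13) and f = assms(14) and h = assms(15) and w_meas = assms(16)
    and exists = assms(18) and w_bounds = assms(19,20,21) and w_eq = assms(22)
  have w_pos: "0 < w_hat x" for x using w_bounds(1) w_bounds(3)[of x] by linarith
  define N where "N = density lborel (\<lambda>x. ennreal (p x))"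
  define S where "S = score f_hat h_hat"
  define x_new where "x_new \<omega> = (c_new \<omega>, z_new \<omega>)" for \<omega>
  \<comment> \<open>The index None stands for the test point, as in the independence assumption.\<close>
  define X where "X = case_option x_new D2"
  define J where "J = insert None (Some ` I2)"
  define V where "V \<omega> = \<alpha> * (\<Sum>i\<in>I2. w_hat (D2 i \<omega>))" for \<omega>
  have sets_N: "sets N = sets borel" by (simp add: N_def)
  have S_meas: "S \<in> borel_measurable borel" unfolding S_def using f h by (rule borel_measurable_score)

  \<comment> \<open>An empty sample has coverage 0 at every scale, so no scale would be feasible.\<close>
  have I2: "I2 \<noteq> {}"
  proof
    assume "I2 = {}"
    then have "AE \<omega> in M. False"
      using exists \<alpha> by (simp add: minimal_scale_exists_def feasible_scale_def weighted_coverage_def)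
    then show False by simp
  qed
  then obtain i0 where "i0 \<in> I2" by blast
  have V_pos: "0 < V \<omega>" for \<omega>
    unfolding V_def using fin I2 w_pos \<alpha> by (intro mult_pos_pos sum_pos) auto
  have law_D2: "distr M borel (D2 i) = N" and D2_meas: "D2 i \<in> borel_measurable M" if "i \<in> I2" for i
    using distributed_distr_eq_density[OF D2[OF that]] distributed_measurable[OF D2[OF that]]
      distr_cong[of M M borel lborel "D2 i" "D2 i"]
    by (auto simp: N_def)
  interpret N: prob_space N
    using M.prob_space_distr[OF D2_meas[OF \<open>i0 \<in> I2\<close>]] law_D2[OF \<open>i0 \<in> I2\<close>] by simp
  have Q: "density N (\<lambda>x. ennreal (w_hat x)) = density lborel (\<lambda>x. ennreal (q x))"
  proof -
    have "ennreal (p x) * ennreal (w_hat x) = ennreal (q x)" for x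
      using p_pos[of x] w_pos[of x] by (simp add: w_eq ennreal_mult'[symmetric])
    then show ?thesis
      unfolding N_def using p_meas w_meas by (subst density_density_eq) auto
  qed
  have x_new_meas: "x_new \<in> borel_measurable M"
    using distributed_measurable[OF new] by (simp add: x_new_def[abs_def])
  have law_new: "distr M borel x_new = density N (\<lambda>x. ennreal (w_hat x))"
    using distributed_distr_eq_density[OF new] distr_cong[of M M borel lborel x_new x_new]
    by (simp add: Q x_new_def[abs_def])
  have Q_prob: "prob_space (density N (\<lambda>x. ennreal (w_hat x)))"
    using M.prob_space_distr[OF x_new_meas] law_new by simp

  \<comment> \<open>A sample in which all scores are infinite admits no feasible scale.\<close>
  have AE_finite_score: "AE x in N. S x \<noteq> \<infinity>"
  proof -
    let ?A = "{x. S x = \<infinity>}"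
    have A: "?A \<in> sets borel"
      using measurable_sets[OF S_meas, of "{\<infinity>}"] by (simp add: vimage_def)
    have "AE \<omega> in M. \<not> (\<forall>j\<in>Some ` I2. X j \<omega> \<in> ?A)"
      using exists
    proof eventually_elim
      case (elim \<omega>)
      show ?case
      proof
        assume "\<forall>j\<in>Some ` I2. X j \<omega> \<in> ?A"
        then have "(\<Sum>i\<in>I2. w_hat (D2 i \<omega>) * of_bool (S (D2 i \<omega>) < \<infinity>)) = 0"
          by (intro sum.neutral) (auto simp: X_def)
        with elim V_pos[of \<omega>] show False
          by (simp add: minimal_scale_exists_iff[OF fin I2 w_pos \<alpha>(1)] V_def S_def
              del: sum_mult_of_bool_eq)
      qed
    qed
    moreover have "M.indep_vars (\<lambda>_. borel) X (Some ` I2)"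
      by (rule M.indep_vars_subset[where I = "insert None (Some ` I2)"])
        (use indep in \<open>auto simp: X_def x_new_def[abs_def]\<close>)
    ultimately have "?A \<in> null_sets N"
      using fin I2 A law_D2
      by (intro M.null_sets_if_AE_not_all_in[where X = X and I = "Some ` I2" and L = borel])
        (auto simp: X_def)
    from AE_not_in[OF this] show ?thesis by simp
  qed
  have atomless: "AE x in N. S x \<noteq> t" for t
  proof (cases "t = \<infinity>")
    case True
    then show ?thesis using AE_finite_score by simp
  next
    case False
    have "AE x in lborel. S x \<noteq> t" unfolding S_def using f h False by (rule AE_lborel_score_neq)
    then show ?thesis unfolding N_def using p_meas by (subst AE_density) auto
  qed

  have joint: "distr M (Pi\<^sub>M J (\<lambda>_. borel)) (\<lambda>\<omega>. \<lambda>j\<in>J. X j \<omega>)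
      = Pi\<^sub>M J (\<lambda>j. if j = None then density N (\<lambda>x. ennreal (w_hat x)) else N)"
  proof -
    have rv: "X j \<in> borel_measurable M" if "j \<in> J" for j
      using that x_new_meas D2_meas by (auto simp: J_def X_def)
    have "distr M (Pi\<^sub>M J (\<lambda>_. borel)) (\<lambda>\<omega>. \<lambda>j\<in>J. X j \<omega>) = Pi\<^sub>M J (\<lambda>j. distr M borel (X j))"
      using M.indep_vars_iff_distr_eq_PiM'[of J X "\<lambda>_. borel"] rv indep
      by (auto simp: J_def X_def x_new_def[abs_def])
    also have "\<dots> = Pi\<^sub>M J (\<lambda>j. if j = None then density N (\<lambda>x. ennreal (w_hat x)) else N)"
      using law_new law_D2 by (intro PiM_cong) (auto simp: J_def X_def)
    finally show ?thesis .
  qed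
  have tuple_meas: "(\<lambda>\<omega>. \<lambda>j\<in>J. X j \<omega>) \<in> measurable M (Pi\<^sub>M J (\<lambda>_. borel))"
    using x_new_meas D2_meas by (intro measurable_restrict) (auto simp: J_def X_def)

  \<comment> \<open>The event that the test point is below the weighted quantile of the sample.\<close>
  define U where
    "U \<omega> \<longleftrightarrow> (\<Sum>i\<in>I2. w_hat (D2 i \<omega>) * of_bool (S (D2 i \<omega>) < S (x_new \<omega>))) < V \<omega>" for \<omega>
  have U_iff: "U \<omega> \<longleftrightarrow>
      below_quantile \<alpha> (\<lambda>j. w_hat ((\<lambda>j\<in>J. X j \<omega>) j)) (\<lambda>j. S ((\<lambda>j\<in>J. X j \<omega>) j)) J None" for \<omega>
  proof -
    have rest: "J - {None} = Some ` I2" and none: "None \<notin> Some ` I2" by (auto simp: J_def)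
    have "sum g J = g None + (\<Sum>i\<in>I2. g (Some i))" "sum g (J - {None}) = (\<Sum>i\<in>I2. g (Some i))"
      for g :: "'i option \<Rightarrow> real"
      unfolding rest using fin none by (simp_all add: J_def sum.reindex)
    then show ?thesis
      by (simp add: below_quantile_def U_def V_def X_def J_def image_iff
          del: sum_mult_of_bool_eq sum_of_bool_mult_eq cong: sum.cong)
  qed
  let ?B = "{x \<in> space (Pi\<^sub>M J (\<lambda>_. N)). below_quantile \<alpha> (\<lambda>j. w_hat (x j)) (\<lambda>j. S (x j)) J None}"
  have sets_PiM: "sets (Pi\<^sub>M J (\<lambda>_. N)) = sets (Pi\<^sub>M J (\<lambda>_. borel))"
    by (rule sets_PiM_cong) (auto simp: sets_N)
  have B: "?B \<in> sets (Pi\<^sub>M J (\<lambda>_. borel))"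
  proof -
    have "Measurable.pred (Pi\<^sub>M J (\<lambda>_. N))
        (\<lambda>x. below_quantile \<alpha> (\<lambda>j. w_hat (x j)) (\<lambda>j. S (x j)) J None)"
      using S_meas w_meas by (intro measurable_below_quantile) (auto simp: N_def J_def)
    then show ?thesis unfolding sets_PiM[symmetric] by (simp add: pred_def)
  qed
  have U_vimage: "{\<omega> \<in> space M. U \<omega>} = (\<lambda>\<omega>. \<lambda>j\<in>J. X j \<omega>) -` ?B \<inter> space M"
    using measurable_space[OF tuple_meas] sets_eq_imp_space_eq[OF sets_PiM] unfolding U_iff by auto
  have U_event: "{\<omega> \<in> space M. U \<omega>} \<in> sets M"
    unfolding U_vimage using tuple_meas B by (rule measurable_sets)
  have prob_U: "M.prob {\<omega> \<in> space M. U \<omega>} =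
      measure (Pi\<^sub>M J (\<lambda>j. if j = None then density N (\<lambda>x. ennreal (w_hat x)) else N)) ?B"
    unfolding U_vimage joint[symmetric] using tuple_meas B by (rule measure_distr[symmetric])

  define T where "T \<omega> \<longleftrightarrow> c_new \<omega> \<in> ood_ro_set f_hat h_hat w_hat \<alpha> I2 (\<lambda>i. D2 i \<omega>) (z_new \<omega>)" for \<omega>
  have T_event: "{\<omega> \<in> space M. T \<omega>} \<in> sets M"
    using sets_mem_ood_ro_set[where w = w_hat, OF fin I2 w_pos \<alpha>(1) D2_meas x_new_meas f h w_meas]
    by (simp add: T_def x_new_def)
  \<comment> \<open>The weight has mean 1 under the training law.\<close>
  have "w_lo \<le> 1"
  proof -
    have "(\<integral>\<^sup>+ x. ennreal w_lo \<partial>N) \<le> (\<integral>\<^sup>+ x. ennreal (w_hat x) \<partial>N)"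
      using w_bounds(3) by (intro nn_integral_mono ennreal_leI) auto
    also have "\<dots> = emeasure (density N (\<lambda>x. ennreal (w_hat x))) (space N)"
      using w_meas by (subst emeasure_density)
        (auto simp: measurable_cong_sets[OF sets_N refl] intro!: nn_integral_cong)
    also have "\<dots> = 1" using prob_space.emeasure_space_1[OF Q_prob] by simp
    finally show ?thesis by (simp add: N.emeasure_space_1 ennreal_le_1)
  qed
  have "AE \<omega> in M. T \<omega> \<longleftrightarrow> U \<omega>"
    using exists
  proof eventually_elim
    case (elim \<omega>)
    from mem_ood_ro_set_iff[where w = w_hat and x = "x_new \<omega>", OF fin I2 w_pos \<alpha>(1) this] show ?case
      by (simp add: T_def U_def V_def S_def x_new_def del: sum_mult_of_bool_eq)
  qed
  then have "M.prob {\<omega> \<in> space M. T \<omega>} = M.prob {\<omega> \<in> space M. U \<omega>}"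
    using T_event U_event by (rule M.prob_eq_AE)
  moreover have "\<bar>M.prob {\<omega> \<in> space M. U \<omega>} - \<alpha>\<bar> \<le> w_up / card J"
    unfolding prob_U
    by (rule weighted_conformal_coverage)
      (use N.prob_space_axioms fin w_meas w_pos w_bounds(3) Q_prob S_meas atomless \<alpha> in
        \<open>auto simp: J_def N_def[symmetric] measurable_cong_sets[OF sets_N refl] intro: less_imp_le\<close>)
  moreover have "real (card J) = real (card I2) + 1"
    using fin by (simp add: J_def card_image)
  moreover have "w_up / (real (card I2) + 1) \<le> 1 / (real (card I2) + 1) * (w_up / w_lo)"
  proof -
    have "w_up \<le> w_up / w_lo"
      using w_bounds(1,2) \<open>w_lo \<le> 1\<close> mult_left_mono[of w_lo 1 w_up] by (simp add: pos_le_divide_eq)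
    from divide_right_mono[OF this, of "real (card I2) + 1"] show ?thesis by (simp add: mult.commute)
  qed
  ultimately show ?thesis unfolding T_def by simp
qed

end
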